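(* Let $P_t$ denote the path on $t$ vertices, and assume that $t\ge c$. Then $$M_c(P_t)=t-\left\lceil\frac{t}{c}\right\rceil .$$ Moreover, this maximum possible number of moves is obtained with a rainbow colouring (with colour-set $\{1,\dots,c\}$).
   Context: Rainbow colouring: let $P=v_1\dots v_n$ be a path with edges $v_iv_{i+1}$ ($1\le i\le n-1$), let $C=\{d_0,\dots,d_{c-1}\}$ be a set of $c$ colours, and let $\omega:V(P)\to C$ be a proper colouring of $P$. The colouring $\omega$ is a $C$-rainbow colouring if there is a permutation $\pi$ of $\{0,\dots,c-1\}$ such that $\omega(v_i)=d_{\pi(i \bmod c)}$ for all $1\le i\le n$. A rainbow colouring is a $C$-rainbow colouring for some colour-set $C$. The (free) Flood-It game: let $G=(V,E)$ be a connected graph with a colouring $\omega:V\to C$, not necessarily proper, where $C$ is a finite colour-set. Two vertices belong to the same monochromatic component if they are joined by a path all of whose vertices have the same colour. A move $(v,d)$, with $v\in V$ and $d\in C$, recolours with colour $d$ every vertex in the monochromatic component (with respect to the current colouring) containing $v$. For $d\in C$, $m(G,\omega,d)$ is the minimum number of moves needed, starting from $\omega$, to give all vertices of $G$ colour $d$, and $m(G,\omega)=\min_{d\in C}m(G,\omega,d)$. For a number of colours $c$, $M_c(G)=\max_\omega m(G,\omega)$, where the maximum is over all surjective colourings $\omega:V\to\{1,\dots,c\}$ (with colour-set $C=\{1,\dots,c\}$).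
   Formalization: For c = 1 and t ≥ 2 no proper colouring of the path with one colour exists, so no rainbow colouring does; there the formal "moreover" claims only the cyclic pattern (the constant colouring), while c ≥ 2 has the full rainbow claim. It is assumed that c ≥ 1. *)

theory Defs
  imports Complex_Main "HOL-Library.FuncSet" "HOL-Combinatorics.Permutations"
begin

text \<open>A graph is a pair of a vertex set and a set of edges, each edge being a two-element set.\<close>

type_synonym 'v graph = "'v set \<times> 'v set set"

abbreviation verts :: "'v graph \<Rightarrow> 'v set" where
  "verts G \<equiv> fst G"

abbreviation edges :: "'v graph \<Rightarrow> 'v set set" where
  "edges G \<equiv> snd G"

definition path_graph :: "nat \<Rightarrow> nat graph" where
  "path_graph t = ({1..t}, {{i, i + 1} | i. 1 \<le> i \<and> i < t})"

definition is_path :: "'v graph \<Rightarrow> 'v list \<Rightarrow> bool" where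
  "is_path G p \<longleftrightarrow> p \<noteq> [] \<and> distinct p \<and> set p \<subseteq> verts G \<and>
     successively (\<lambda>x y. {x, y} \<in> edges G) p"

definition proper_colouring :: "'v graph \<Rightarrow> ('v \<Rightarrow> 'a) \<Rightarrow> bool" where
  "proper_colouring G \<omega> \<longleftrightarrow>
     (\<forall>x \<in> verts G. \<forall>y \<in> verts G. {x, y} \<in> edges G \<longrightarrow> \<omega> x \<noteq> \<omega> y)"

definition mono_component :: "'v graph \<Rightarrow> ('v \<Rightarrow> 'a) \<Rightarrow> 'v \<Rightarrow> 'v set" where
  "mono_component G \<omega> v =
     {u. \<exists>p. is_path G p \<and> hd p = v \<and> last p = u \<and> (\<forall>x \<in> set p. \<omega> x = \<omega> v)}"

definition flood_move :: "'v graph \<Rightarrow> 'v \<times> 'a \<Rightarrow> ('v \<Rightarrow> 'a) \<Rightarrow> ('v \<Rightarrow> 'a)" where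
  "flood_move G mv \<omega> =
     (\<lambda>x. if x \<in> mono_component G \<omega> (fst mv) then snd mv else \<omega> x)"

text \<open>A sequence of moves is a list, whose head is played first. In a connected graph every
  colour in \<open>C\<close> can be made to flood the whole graph, so the \<open>LEAST\<close> below ranges over a
  nonempty set.\<close>

definition floods :: "'v graph \<Rightarrow> 'a set \<Rightarrow> ('v \<Rightarrow> 'a) \<Rightarrow> 'a \<Rightarrow> ('v \<times> 'a) list \<Rightarrow> bool" where
  "floods G C \<omega> d ms \<longleftrightarrow>
     set ms \<subseteq> verts G \<times> C \<and> (\<forall>x \<in> verts G. fold (flood_move G) ms \<omega> x = d)"

definition min_moves_to :: "'v graph \<Rightarrow> 'a set \<Rightarrow> ('v \<Rightarrow> 'a) \<Rightarrow> 'a \<Rightarrow> nat" where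
  "min_moves_to G C \<omega> d = (LEAST k. \<exists>ms. length ms = k \<and> floods G C \<omega> d ms)"

definition min_moves :: "'v graph \<Rightarrow> 'a set \<Rightarrow> ('v \<Rightarrow> 'a) \<Rightarrow> nat" where
  "min_moves G C \<omega> = Min (min_moves_to G C \<omega> ` C)"

text \<open>Colourings are taken to be extensional functions, so that a finite graph has only finitely
  many of them and the maximum is over a finite set.\<close>

definition surj_colourings :: "'v graph \<Rightarrow> 'a set \<Rightarrow> ('v \<Rightarrow> 'a) set" where
  "surj_colourings G C = {\<omega> \<in> verts G \<rightarrow>\<^sub>E C. \<omega> ` verts G = C}"

definition max_moves :: "nat \<Rightarrow> 'v graph \<Rightarrow> nat" where
  "max_moves c G = Max (min_moves G {1..c} ` surj_colourings G {1..c})"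

text \<open>The enumeration \<open>d\<close> names the colours of \<open>C\<close> as \<open>d 0, \<dots>, d (c - 1)\<close>. The pattern
  alone already forces properness when \<open>C\<close> has at least two colours; with a single colour it
  describes the constant colouring, which is proper only on a path with at most one vertex.\<close>

definition rainbow_pattern :: "nat \<Rightarrow> 'a set \<Rightarrow> (nat \<Rightarrow> 'a) \<Rightarrow> bool" where
  "rainbow_pattern n C \<omega> \<longleftrightarrow>
     (\<exists>d \<pi>. bij_betw d {..<card C} C \<and> \<pi> permutes {..<card C} \<and>
        (\<forall>i \<in> {1..n}. \<omega> i = d (\<pi> (i mod card C))))"

definition rainbow_colouring :: "nat \<Rightarrow> 'a set \<Rightarrow> (nat \<Rightarrow> 'a) \<Rightarrow> bool" where
  "rainbow_colouring n C \<omega> \<longleftrightarrow>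
     proper_colouring (path_graph n) \<omega> \<and> rainbow_pattern n C \<omega>"

end

theory Submission
  imports Defs
begin

text \<open>
  For the upper bound, some colour occurs on at least \<open>\<lceil>t / c\<rceil>\<close> vertices; flood with it, spending
  one move on each other vertex.

  For the lower bound, consider noncrossing partitions of the path into (not necessarily connected)
  monochromatic parts, and the least number of parts in such a partition. One move lowers this
  number by at most one: given a partition for the colouring after the move, cut the recoloured
  interval \<open>I\<close> out of all parts and add \<open>I\<close> as a new part; an interval crosses nothing. So a
  colouring that can be flooded in \<open>k\<close> moves has a noncrossing monochromatic partition into at most
  \<open>k + 1\<close> parts. In a rainbow colouring the elements of a part agree modulo \<open>c\<close>, and an induction
  on the length of the path shows that a noncrossing partition of this kind has at least
  \<open>t - \<lceil>t / c\<rceil> + 1\<close> parts.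
\<close>

section \<open>Noncrossing partitions of an interval\<close>

text \<open>A partition is represented by a labelling \<open>g\<close>, whose fibres are the parts.\<close>

definition noncrossing_on :: "nat set \<Rightarrow> (nat \<Rightarrow> 'b) \<Rightarrow> bool" where
  "noncrossing_on A g \<longleftrightarrow>
     (\<forall>w\<in>A. \<forall>x\<in>A. \<forall>y\<in>A. \<forall>z\<in>A. w < x \<and> x < y \<and> y < z \<and> g w = g y \<and> g x = g z \<longrightarrow> g w = g x)"

lemma noncrossing_onD:
  "\<lbrakk>noncrossing_on A g; w \<in> A; x \<in> A; y \<in> A; z \<in> A; w < x; x < y; y < z; g w = g y; g x = g z\<rbrakk>
    \<Longrightarrow> g w = g x"
  unfolding noncrossing_on_def by (drule (1) bspec)+ (rule mp, assumption, intro conjI)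

lemma noncrossing_on_subset:
  assumes "noncrossing_on A g" and "B \<subseteq> A"
  shows "noncrossing_on B g"
  unfolding noncrossing_on_def
proof (intro ballI impI, elim conjE)
  fix w x y z
  assume "w \<in> B" "x \<in> B" "y \<in> B" "z \<in> B"
  then have "w \<in> A" "x \<in> A" "y \<in> A" "z \<in> A" using assms(2) by blast+
  moreover assume "w < x" "x < y" "y < z" "g w = g y" "g x = g z"
  ultimately show "g w = g x" by (rule noncrossing_onD[OF assms(1)])
qed

text \<open>For \<open>n > 0\<close>, \<open>(n - 1) div c = \<lceil>n / c\<rceil> - 1\<close>. In this form the bound also covers \<open>n = 0\<close>, as
  needed when two equal labels are adjacent.\<close>

lemma card_noncrossing_mod_ge:
  fixes g :: "nat \<Rightarrow> 'b"
  assumes "c > 0" and "noncrossing_on {a..<a + n} g"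
    and "\<And>x y. x \<in> {a..<a + n} \<Longrightarrow> y \<in> {a..<a + n} \<Longrightarrow> g x = g y \<Longrightarrow> x mod c = y mod c"
  shows "n \<le> card (g ` {a..<a + n}) + (n - 1) div c"
  using assms(2,3)
proof (induction n arbitrary: a rule: less_induct)
  case (less n)
  note nc = less.prems(1) and cong = less.prems(2)
  have IH: "m \<le> card (g ` {b..<b + m}) + (m - 1) div c" if "m < n" "{b..<b + m} \<subseteq> {a..<a + n}" for b m
    using less.IH[OF that(1), of b] noncrossing_on_subset[OF nc that(2)] cong that(2) by blast
  show ?case
  proof (cases "n = 0")
    case False
    show ?thesis
    proof (cases "\<exists>j. a < j \<and> j < a + n \<and> g j = g a")
      \<comment> \<open>The part of \<open>a\<close> is a singleton, so deleting \<open>a\<close>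
        lowers length and number of parts by one each.\<close>
      case False
      have eq: "{a..<a + n} = insert a {Suc a..<Suc a + (n - 1)}" using \<open>n \<noteq> 0\<close> by auto
      have "g a \<notin> g ` {Suc a..<Suc a + (n - 1)}"
      proof
        assume "g a \<in> g ` {Suc a..<Suc a + (n - 1)}"
        then obtain j where "j \<in> {Suc a..<Suc a + (n - 1)}" "g a = g j" by blast
        then have "a < j \<and> j < a + n \<and> g j = g a" by auto
        with False show False by blast
      qed
      then have "card (g ` {a..<a + n}) = Suc (card (g ` {Suc a..<Suc a + (n - 1)}))"
        unfolding eq by simp
      moreover have "n - 1 \<le> card (g ` {Suc a..<Suc a + (n - 1)}) + (n - 1 - 1) div c"
        using \<open>n \<noteq> 0\<close> by (intro IH) auto
      moreover have "(n - 1 - 1) div c \<le> (n - 1) div c" by (intro div_le_mono) simp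
      ultimately show ?thesis by linarith
    next
      case True
      \<comment> \<open>\<open>j\<close> is the next element of the part of \<open>a\<close>, at
        distance a multiple of \<open>c\<close>.\<close>
      define j where "j = (LEAST j. a < j \<and> j < a + n \<and> g j = g a)"
      have j: "a < j" "j < a + n" "g j = g a"
        using LeastI_ex[OF True] unfolding j_def by auto
      have j_least: "g x \<noteq> g a" if "a < x" "x < j" for x
        using not_less_Least[of x "\<lambda>j. a < j \<and> j < a + n \<and> g j = g a"] that j(2)
        unfolding j_def[symmetric] by auto
      have "j mod c = a mod c" using cong[of j a] j by auto
      then have "c dvd j - a" using j(1) by (simp add: mod_eq_dvd_iff_nat)
      then obtain k where k: "j = a + c * k" using j(1) by (metis dvdE le_add_diff_inverse less_imp_le)
      have k_pos: "k > 0" using k j(1) by (cases k) auto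
      \<comment> \<open>The part of \<open>a\<close> is counted in \<open>?J\<close>, through
        \<open>j\<close>, so \<open>a\<close> itself is left out of both blocks.\<close>
      let ?I = "{Suc a..<Suc a + (c * k - 1)}" and ?J = "{j..<j + (n - c * k)}"
      have I: "?I = {a<..<j}" using k j(1) by auto
      have J: "?J = {j..<a + n}" using k j by auto
      have disj: "g ` ?I \<inter> g ` ?J = {}"
      proof -
        \<comment> \<open>For \<open>y > j\<close> the points \<open>a\<close>, \<open>x\<close>,
          \<open>j\<close>, \<open>y\<close> would be a crossing; \<open>y = j\<close> would
          contradict the minimality of \<open>j\<close>.\<close>
        have False if "x \<in> {a<..<j}" "y \<in> {j..<a + n}" "g x = g y" for x y
        proof (cases "y = j")
          case True
          then show False using that j_least[of x] j by auto
        next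
          case False
          then have "g a = g x"
            using that j by (intro noncrossing_onD[OF nc, of a x j y]) auto
          then show False using that j_least[of x] by auto
        qed
        then show ?thesis unfolding I J by blast
      qed
      have "card (g ` ?I) + card (g ` ?J) = card (g ` (?I \<union> ?J))"
        using disj by (simp add: image_Un card_Un_disjoint)
      also have "\<dots> \<le> card (g ` {a..<a + n})"
        unfolding I J using j by (intro card_mono image_mono) auto
      finally have card: "card (g ` ?I) + card (g ` ?J) \<le> card (g ` {a..<a + n})" .
      have len_I: "c * k - 1 \<le> card (g ` ?I) + (c * k - 1 - 1) div c"
        using j k unfolding I by (intro IH[of "c * k - 1" "Suc a", unfolded I]) auto
      have len_J: "n - c * k \<le> card (g ` ?J) + (n - c * k - 1) div c"
        using j k unfolding J by (intro IH[of "n - c * k" j, unfolded J]) auto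
      \<comment> \<open>The lengths of \<open>?I\<close> and \<open>?J\<close> add up to
        \<open>n - 1\<close> only. The strict inequality makes up for the missing \<open>a\<close>:
        the two quotients add up to at most \<open>(n - 1) div c - 1\<close>.\<close>
      have "c * k > 0" using assms(1) k_pos by simp
      then have "(c * k - 1 - 1) div c < k"
        by (intro less_mult_imp_div_less) (simp add: mult.commute)
      moreover have "(n - 1) div c = (n - c * k - 1) div c + k"
      proof -
        have "n - 1 = (n - c * k - 1) + k * c" using j k by (simp add: mult.commute)
        then show ?thesis using assms(1) by simp
      qed
      ultimately show ?thesis using card len_I len_J j k by linarith
    qed
  qed simp
qed

section \<open>Monochromatic components of a path are intervals\<close>

lemma mono_component_refl: "v \<in> verts G \<Longrightarrow> v \<in> mono_component G \<omega> v"
  unfolding mono_component_def is_path_def by (intro CollectI exI[of _ "[v]"]) simp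

lemma mono_component_colour:
  assumes "u \<in> mono_component G \<omega> v"
  shows "\<omega> u = \<omega> v"
proof -
  obtain p where "p \<noteq> []" "last p = u" "\<forall>x\<in>set p. \<omega> x = \<omega> v"
    using assms unfolding mono_component_def is_path_def by blast
  then show ?thesis using last_in_set[of p] by blast
qed

text \<open>A discrete intermediate value theorem: each step changes the position by one, so after
  dropping a first vertex other than \<open>y\<close>, the vertex \<open>y\<close> still lies
  between the new ends.\<close>

lemma path_meets_between:
  assumes "successively (\<lambda>x y. {x, y} \<in> edges (path_graph t)) p" and "p \<noteq> []"
    and "min (hd p) (last p) \<le> y" and "y \<le> max (hd p) (last p)"
  shows "y \<in> set p"
  using assms
proof (induction p)
  case (Cons a p)
  show ?case
  proof (cases "p = [] \<or> y = a")
    case False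
    then obtain b q where p: "p = b # q" by (cases p) auto
    have "{a, b} \<in> edges (path_graph t)" using Cons.prems(1) p by simp
    then have "a = Suc b \<or> b = Suc a" unfolding path_graph_def by (auto simp: doubleton_eq_iff)
    then have "y \<in> set p"
      using Cons.prems False p by (intro Cons.IH) auto
    then show ?thesis by simp
  qed (use Cons.prems in auto)
qed simp

text \<open>A monochromatic path from \<open>v\<close> to \<open>u\<close> passes through
  \<open>y\<close>; cut it off there.\<close>

lemma mono_component_path_interval:
  assumes "u \<in> mono_component (path_graph t) \<omega> v"
    and "min v u \<le> y" and "y \<le> max v u"
  shows "y \<in> mono_component (path_graph t) \<omega> v"
proof -
  obtain p where p: "is_path (path_graph t) p" "hd p = v" "last p = u" "\<forall>x\<in>set p. \<omega> x = \<omega> v"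
    using assms(1) unfolding mono_component_def by auto
  have "y \<in> set p"
    using p assms(2,3) by (intro path_meets_between[of t]) (auto simp: is_path_def)
  then obtain q r where q: "p = q @ y # r" by (meson split_list)
  have "is_path (path_graph t) (q @ [y])"
    using p(1) unfolding is_path_def q by (auto simp: successively_append_iff)
  moreover have "hd (q @ [y]) = v" using p(2) q by (cases q) auto
  ultimately show ?thesis
    using p(4) unfolding mono_component_def q by (auto intro!: exI[of _ "q @ [y]"])
qed

lemma mono_component_path_convex:
  assumes "x \<in> mono_component (path_graph t) \<omega> v" and "z \<in> mono_component (path_graph t) \<omega> v"
    and "x \<le> y" and "y \<le> z"
  shows "y \<in> mono_component (path_graph t) \<omega> v"
proof (cases "y \<le> v")
  case True
  then show ?thesis using assms by (intro mono_component_path_interval[OF assms(1)]) auto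
next
  case False
  then show ?thesis using assms by (intro mono_component_path_interval[OF assms(2)]) auto
qed

section \<open>From floodings to noncrossing partitions\<close>

text \<open>The bound counts one part for the final constant colouring and one more for each move
  undone. The induction runs from the first move, hence for arbitrary
  \<open>\<omega>\<close>.\<close>

lemma noncrossing_partition_of_flooding:
  assumes "\<forall>x\<in>{1..t}. fold (flood_move (path_graph t)) ms \<omega> x = d"
  shows "\<exists>g :: nat \<Rightarrow> nat. noncrossing_on {1..t} g \<and>
    (\<forall>x\<in>{1..t}. \<forall>y\<in>{1..t}. g x = g y \<longrightarrow> \<omega> x = \<omega> y) \<and> card (g ` {1..t}) \<le> Suc (length ms)"
  using assms
proof (induction ms arbitrary: \<omega>)
  case Nil
  have "card ((\<lambda>_::nat. 0::nat) ` {1..t}) \<le> card {0::nat}" by (intro card_mono) auto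
  then show ?case using Nil by (intro exI[of _ "\<lambda>_. 0"]) (auto simp: noncrossing_on_def)
next
  case (Cons mv ms)
  obtain g :: "nat \<Rightarrow> nat" where g: "noncrossing_on {1..t} g"
    "\<forall>x\<in>{1..t}. \<forall>y\<in>{1..t}. g x = g y \<longrightarrow>
       flood_move (path_graph t) mv \<omega> x = flood_move (path_graph t) mv \<omega> y"
    "card (g ` {1..t}) \<le> Suc (length ms)"
    using Cons.IH[of "flood_move (path_graph t) mv \<omega>"] Cons.prems by auto
  let ?I = "mono_component (path_graph t) \<omega> (fst mv)"
  \<comment> \<open>A fresh label makes the recoloured interval a part of its own.\<close>
  obtain e where e: "e \<notin> g ` {1..t}"
    using ex_new_if_finite[of "g ` {1..t}"] by auto
  define h where "h x = (if x \<in> ?I then e else g x)" for x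
  have h_eq: "(x \<in> ?I \<longleftrightarrow> y \<in> ?I) \<and> (x \<notin> ?I \<longrightarrow> g x = g y)"
    if "x \<in> {1..t}" "y \<in> {1..t}" "h x = h y" for x y
    using that e unfolding h_def by (auto split: if_splits)
  have "noncrossing_on {1..t} h"
    unfolding noncrossing_on_def
  proof (intro ballI impI, elim conjE)
    fix w x y z
    assume A: "w \<in> {1..t}" "x \<in> {1..t}" "y \<in> {1..t}" "z \<in> {1..t}"
      and lt: "w < x" "x < y" "y < z" and eq: "h w = h y" "h x = h z"
    show "h w = h x"
    proof (cases "w \<in> ?I \<or> x \<in> ?I")
      \<comment> \<open>Two points of one part lie in \<open>?I\<close>, and by convexity so does
        the point of the other part between them; hence both parts are \<open>?I\<close>.\<close>
      case True
      then have "w \<in> ?I \<and> y \<in> ?I \<or> x \<in> ?I \<and> z \<in> ?I"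
        using h_eq[OF A(1,3) eq(1)] h_eq[OF A(2,4) eq(2)] by blast
      then have "x \<in> ?I \<or> y \<in> ?I"
        by blast
      moreover have "x \<in> ?I" if "w \<in> ?I"
        using that h_eq[OF A(1,3) eq(1)] lt by (intro mono_component_path_convex[of w t \<omega> _ y x]) auto
      moreover have "y \<in> ?I" if "x \<in> ?I"
        using that h_eq[OF A(2,4) eq(2)] lt by (intro mono_component_path_convex[of x t \<omega> _ z y]) auto
      ultimately have "w \<in> ?I" "x \<in> ?I"
        using h_eq[OF A(1,3) eq(1)] by blast+
      then show ?thesis unfolding h_def by simp
    next
      case False
      then have "g w = g x"
        using h_eq[OF A(1,3) eq(1)] h_eq[OF A(2,4) eq(2)] A lt
        by (intro noncrossing_onD[OF g(1), of w x y z]) auto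
      then show ?thesis using False unfolding h_def by simp
    qed
  qed
  \<comment> \<open>Parts must be monochromatic before the move: \<open>?I\<close> is so as a
    component, and outside \<open>?I\<close> the move changes nothing.\<close>
  moreover have "\<omega> x = \<omega> y" if "x \<in> {1..t}" "y \<in> {1..t}" "h x = h y" for x y
  proof (cases "x \<in> ?I")
    case True
    then show ?thesis
      using h_eq[OF that] mono_component_colour[of _ "path_graph t" \<omega> "fst mv"] by metis
  next
    case False
    then have "y \<notin> ?I" "g x = g y" using h_eq[OF that] by auto
    then have "flood_move (path_graph t) mv \<omega> x = flood_move (path_graph t) mv \<omega> y"
      using g(2) that by blast
    then show ?thesis using False \<open>y \<notin> ?I\<close> unfolding flood_move_def by simp
  qed
  moreover have "card (h ` {1..t}) \<le> Suc (length (mv # ms))"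
  proof -
    have "card (h ` {1..t}) \<le> card (insert e (g ` {1..t}))"
      by (intro card_mono) (auto simp: h_def)
    also have "\<dots> \<le> Suc (card (g ` {1..t}))" by (simp add: card_insert_if)
    finally show ?thesis using g(3) by simp
  qed
  ultimately show ?case by blast
qed

section \<open>Flooding vertex by vertex\<close>

text \<open>Every move paints with \<open>d\<close>, so a vertex that has colour \<open>d\<close>
  keeps it; the disjunction is the invariant of the induction.\<close>

lemma fold_flood_same_colour:
  assumes "set vs \<subseteq> verts G" and "\<omega> x = d \<or> x \<in> set vs"
  shows "fold (flood_move G) (map (\<lambda>v. (v, d)) vs) \<omega> x = d"
  using assms
proof (induction vs arbitrary: \<omega>)
  case (Cons v vs)
  have "flood_move G (v, d) \<omega> x = d \<or> x \<in> set vs"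
    using Cons.prems mono_component_refl[of v G \<omega>] unfolding flood_move_def by auto
  then show ?case using Cons.IH[of "flood_move G (v, d) \<omega>"] Cons.prems(1) by simp
qed simp

text \<open>Besides the upper bound, this shows that the \<open>LEAST\<close> in
  \<open>min_moves_to\<close> is attained.\<close>

lemma floods_vertexwise:
  assumes "finite (verts G)" and "d \<in> C"
  shows "\<exists>ms. length ms = card {v \<in> verts G. \<omega> v \<noteq> d} \<and> floods G C \<omega> d ms"
proof -
  obtain vs where vs: "set vs = {v \<in> verts G. \<omega> v \<noteq> d}" "distinct vs"
    using finite_distinct_list[of "{v \<in> verts G. \<omega> v \<noteq> d}"] assms(1) by auto
  have "floods G C \<omega> d (map (\<lambda>v. (v, d)) vs)"
    unfolding floods_def using vs(1) assms(2) by (auto intro!: fold_flood_same_colour)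
  moreover have "length vs = card {v \<in> verts G. \<omega> v \<noteq> d}"
    using vs distinct_card by metis
  ultimately show ?thesis by (intro exI[of _ "map (\<lambda>v. (v, d)) vs"]) simp
qed

lemma min_moves_to_le:
  assumes "finite (verts G)" and "d \<in> C"
  shows "min_moves_to G C \<omega> d \<le> card {v \<in> verts G. \<omega> v \<noteq> d}"
  unfolding min_moves_to_def by (rule Least_le, rule floods_vertexwise[OF assms])

lemma min_moves_to_attained:
  assumes "finite (verts G)" and "d \<in> C"
  shows "\<exists>ms. length ms = min_moves_to G C \<omega> d \<and> floods G C \<omega> d ms"
  unfolding min_moves_to_def by (rule LeastI, rule floods_vertexwise[OF assms])

section \<open>Upper and lower bounds for paths\<close>

lemma verts_path_graph [simp]: "verts (path_graph t) = {1..t}"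
  by (simp add: path_graph_def)

lemma min_moves_path_le:
  assumes "1 \<le> c" and "1 \<le> t" and "\<omega> \<in> surj_colourings (path_graph t) {1..c}"
  shows "min_moves (path_graph t) {1..c} \<omega> \<le> t - 1 - (t - 1) div c"
proof -
  let ?q = "(t - 1) div c"
  have \<omega>: "\<omega> ` {1..t} \<subseteq> {1..c}" using assms(3) unfolding surj_colourings_def by simp
  \<comment> \<open>Pigeonhole: with at most \<open>?q\<close> vertices of each colour there would
    be at most \<open>c * ?q \<le> t - 1\<close> vertices.\<close>
  have "\<exists>d\<in>{1..c}. ?q < card {v \<in> {1..t}. \<omega> v = d}"
  proof (rule ccontr)
    assume "\<not> ?thesis"
    then have le: "card {v \<in> {1..t}. \<omega> v = d} \<le> ?q" if "d \<in> {1..c}" for d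
      using that by (meson not_less)
    have "t = (\<Sum>d\<in>{1..c}. card {v \<in> {1..t}. \<omega> v = d})"
      using sum.group[of "{1..t}" "{1..c}" \<omega> "\<lambda>_. 1::nat"] \<omega> by simp
    also have "\<dots> \<le> (\<Sum>d\<in>{1..c}. ?q)" by (intro sum_mono le)
    also have "\<dots> \<le> t - 1" by simp
    finally show False using assms(2) by simp
  qed
  then obtain d where d: "d \<in> {1..c}" "?q < card {v \<in> {1..t}. \<omega> v = d}" by blast
  have "card {v \<in> {1..t}. \<omega> v = d} + card {v \<in> {1..t}. \<omega> v \<noteq> d} = t"
    using card_Int_Diff[of "{1..t}" "{v. \<omega> v = d}"]
    by (simp add: Int_def set_diff_eq)
  moreover have "min_moves (path_graph t) {1..c} \<omega> \<le> min_moves_to (path_graph t) {1..c} \<omega> d"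
    unfolding min_moves_def using d(1) by (intro Min_le) auto
  moreover have "\<dots> \<le> card {v \<in> {1..t}. \<omega> v \<noteq> d}"
    using min_moves_to_le[of "path_graph t" d "{1..c}" \<omega>] d(1) by simp
  ultimately show ?thesis using d(2) by linarith
qed

text \<open>A flooding in \<open>k\<close> moves, whatever its final colour, gives at most
  \<open>k + 1\<close> parts, each inside one residue class modulo \<open>c\<close>; the count of
  such parts then bounds \<open>k\<close> from below.\<close>

lemma min_moves_path_ge:
  assumes "1 \<le> c" and "\<And>x y. x \<in> {1..t} \<Longrightarrow> y \<in> {1..t} \<Longrightarrow> \<omega> x = \<omega> y \<Longrightarrow> x mod c = y mod c"
  shows "t - 1 - (t - 1) div c \<le> min_moves (path_graph t) {1..c} \<omega>"
proof -
  have "t - 1 - (t - 1) div c \<le> min_moves_to (path_graph t) {1..c} \<omega> d" if d: "d \<in> {1..c}" for d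
  proof -
    obtain ms where ms: "length ms = min_moves_to (path_graph t) {1..c} \<omega> d"
      "floods (path_graph t) {1..c} \<omega> d ms"
      using min_moves_to_attained[of "path_graph t" d "{1..c}" \<omega>] d by auto
    have "\<forall>x\<in>{1..t}. fold (flood_move (path_graph t)) ms \<omega> x = d"
      using ms(2) unfolding floods_def by simp
    from noncrossing_partition_of_flooding[OF this]
    obtain g :: "nat \<Rightarrow> nat" where g: "noncrossing_on {1..t} g"
      "\<forall>x\<in>{1..t}. \<forall>y\<in>{1..t}. g x = g y \<longrightarrow> \<omega> x = \<omega> y" "card (g ` {1..t}) \<le> Suc (length ms)"
      by blast
    have interval: "{1..<1 + t} = {1..t}" by auto
    have "t \<le> card (g ` {1..t}) + (t - 1) div c"
    proof (rule card_noncrossing_mod_ge[of c 1 t g, unfolded interval])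
      show "0 < c" using assms(1) by simp
      show "noncrossing_on {1..t} g" by (rule g(1))
      fix x y assume "x \<in> {1..t}" "y \<in> {1..t}" "g x = g y"
      then show "x mod c = y mod c" using g(2) by (intro assms(2)) blast+
    qed
    then show ?thesis using g(3) ms(1) by linarith
  qed
  then show ?thesis
    unfolding min_moves_def using assms(1) by (intro Min.boundedI) auto
qed

text \<open>With \<open>q = (t - 1) div c\<close> one has
  \<open>q * c < t \<le> (q + 1) * c\<close>.\<close>

lemma ceiling_divide_nat:
  assumes "1 \<le> c" and "1 \<le> t"
  shows "\<lceil>real t / real c\<rceil> = int ((t - 1) div c) + 1"
proof (rule ceiling_unique)
  let ?q = "(t - 1) div c"
  have "?q * c \<le> t - 1" by simp
  then have "?q * c < t" using assms(2) by linarith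
  then have "real ?q * real c < real t" by (metis of_nat_less_iff of_nat_mult)
  then show "real_of_int (int ?q + 1) - 1 < real t / real c"
    using assms(1) by (simp add: pos_less_divide_eq)
  have "t - 1 < Suc ?q * c" using assms(1) dividend_less_div_times[of c "t - 1"] by simp
  then have "t \<le> Suc ?q * c" using assms(2) by linarith
  then have "real t \<le> real (Suc ?q) * real c" by (metis of_nat_le_iff of_nat_mult)
  then show "real t / real c \<le> real_of_int (int ?q + 1)"
    using assms(1) by (simp add: pos_divide_le_eq add.commute)
qed

section \<open>The exact maximum and a rainbow colouring attaining it\<close>

theorem corollary2p10:
  fixes t c :: nat
  assumes "1 \<le> c" and "c \<le> t"
  shows "int (max_moves c (path_graph t)) = int t - \<lceil>real t / real c\<rceil> \<and>
    (\<exists>\<omega> \<in> surj_colourings (path_graph t) {1..c}.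
       rainbow_pattern t {1..c} \<omega> \<and>
       (2 \<le> c \<longrightarrow> rainbow_colouring t {1..c} \<omega>) \<and>
       min_moves (path_graph t) {1..c} \<omega> = max_moves c (path_graph t))"
proof -
  let ?m = "t - 1 - (t - 1) div c" and ?S = "surj_colourings (path_graph t) {1..c}"
  have t: "1 \<le> t" using assms by simp
  define \<omega> where "\<omega> = restrict (\<lambda>i. Suc (i mod c)) {1..t}"
  have \<omega>: "\<omega> i = Suc (i mod c)" if "i \<in> {1..t}" for i
    using that unfolding \<omega>_def by simp
  have mod_less: "i mod c < c" for i using assms(1) by simp
  have "{1..c} \<subseteq> \<omega> ` {1..t}"
  proof
    fix d assume d: "d \<in> {1..c}"
    \<comment> \<open>Colour 1 belongs to residue 0, which first occurs at vertex \<open>c\<close>;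
      this is where \<open>c \<le> t\<close> enters.\<close>
    let ?i = "if d = 1 then c else d - 1"
    have "?i \<in> {1..t}" "Suc (?i mod c) = d" using d assms by auto
    then show "d \<in> \<omega> ` {1..t}" using \<omega> by (metis imageI)
  qed
  moreover have "\<omega> \<in> {1..t} \<rightarrow>\<^sub>E {1..c}"
    unfolding \<omega>_def using mod_less by (auto simp: Suc_le_eq)
  ultimately have S: "\<omega> \<in> ?S" unfolding surj_colourings_def by auto
  have pattern: "rainbow_pattern t {1..c} \<omega>"
    unfolding rainbow_pattern_def
  proof (intro exI conjI ballI)
    show "bij_betw Suc {..<card {1..c}} {1..c}"
      by (rule bij_betwI[of _ _ _ "\<lambda>i. i - 1"]) auto
    show "id permutes {..<card {1..c}}" by (rule permutes_id)
  qed (simp add: \<omega>)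
  have "proper_colouring (path_graph t) \<omega>" if "2 \<le> c"
  proof -
    \<comment> \<open>The step from residue \<open>c - 1\<close> back to 0 changes the colour
      because \<open>c \<ge> 2\<close>.\<close>
    have "\<omega> i \<noteq> \<omega> (Suc i)" if "1 \<le> i" "i < t" for i
      using that \<omega>[of i] \<omega>[of "Suc i"] \<open>2 \<le> c\<close> by (auto simp: mod_Suc)
    then show ?thesis
      unfolding proper_colouring_def path_graph_def
      by (fastforce simp: doubleton_eq_iff)
  qed
  then have rainbow: "2 \<le> c \<longrightarrow> rainbow_colouring t {1..c} \<omega>"
    using pattern unfolding rainbow_colouring_def by blast
  have ge: "?m \<le> min_moves (path_graph t) {1..c} \<omega>"
    using assms(1) by (intro min_moves_path_ge) (auto simp: \<omega>)
  have moves: "min_moves (path_graph t) {1..c} \<omega> = ?m"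
    using ge min_moves_path_le[OF assms(1) t S] by simp
  have "finite ?S"
    by (rule finite_subset[of _ "{1..t} \<rightarrow>\<^sub>E {1..c}"])
      (auto simp: surj_colourings_def intro!: finite_PiE)
  then have max: "max_moves c (path_graph t) = ?m"
    unfolding max_moves_def using min_moves_path_le[OF assms(1) t] S moves
    by (intro Max_eqI) (auto intro: rev_image_eqI)
  \<comment> \<open>This makes the truncated subtraction in \<open>?m\<close> agree with subtraction
    of integers.\<close>
  have "(t - 1) div c \<le> t - 1" by (rule div_le_dividend)
  then have "int ?m = int t - \<lceil>real t / real c\<rceil>"
    using t unfolding ceiling_divide_nat[OF assms(1) t] by linarith
  with max moves S pattern rainbow show ?thesis by metis
qed

end
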